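(* Let $m\ge2$ be an integer, let $\lambda$ be an integer with $1\le\lambda\le m-1$, and let $\alpha<1+1/\lambda$. Consider makespan scheduling with predictions on $m$ identical machines under interval uncertainty. Then: (i) for no $\beta<\lambda$ is there a deterministic algorithm that is $\alpha$-consistent and $\beta$-robust; (ii) for no $\beta<\lambda/4$ is there a randomized algorithm that is $\alpha$-consistent and $\beta$-robust (in expectation).
   Context: There are $m$ machines and $n$ jobs. On identical machines a scenario is a vector of job sizes $p\in\mathbb R_{\ge0}^n$. A schedule is a partition $\mathcal S=(S_1,\dots,S_m)$ of $[n]$ (parts may be empty), and $C_{\max}(\mathcal S,p)=\max_{i}\sum_{j\in S_i}p_j$. $\mathrm{OPT}(p)=\min_{\mathcal S}C_{\max}(\mathcal S,p)$ and $\mathrm{OPT}^{\mathrm{rob}}(\mathcal U)=\min_{\mathcal S}\max_{p\in\mathcal U}C_{\max}(\mathcal S,p)$, minima over deterministic schedules. Interval uncertainty: for given $0\le p_j^-\le p_j^+$, $\mathcal U=\{p:p_j\in[p_j^-,p_j^+]\ \forall j\in[n]\}$. A deterministic algorithm maps each input $(\mathcal U,\hat p)$, where $\mathcal U$ is an interval uncertainty set (any number $n$ of jobs) and $\hat p\in\mathcal U$ is the predicted scenario, to a schedule $\mathcal S$. It is $\alpha$-consistent if $C_{\max}(\mathcal S,\hat p)\le\alpha\,\mathrm{OPT}(\hat p)$ for all inputs, and $\beta$-robust if $\max_{p\in\mathcal U}C_{\max}(\mathcal S,p)\le\beta\,\mathrm{OPT}^{\mathrm{rob}}(\mathcal U)$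 for all inputs. A randomized algorithm returns a random schedule $\mathcal S$; it is $\alpha$-consistent if $\mathbb E[C_{\max}(\mathcal S,\hat p)]\le\alpha\,\mathrm{OPT}(\hat p)$ and $\beta$-robust if $\mathbb E[C_{\max}(\mathcal S,p)]\le\beta\,\mathrm{OPT}^{\mathrm{rob}}(\mathcal U)$ for every $p\in\mathcal U$, for all inputs. No computational restriction is imposed. *)

theory Defs
  imports "HOL-Probability.Probability"
begin

text \<open>
  Jobs are the numbers below \<open>n\<close>, and a scenario is a list \<open>p\<close> of length \<open>n\<close> of job sizes.
  A schedule is the list of the \<open>m\<close> sets of jobs assigned to the machines, some of which may
  be empty.
\<close>

definition schedules :: "nat \<Rightarrow> nat \<Rightarrow> nat set list set" where
  "schedules m n = {S. length S = m \<and> (\<Union>i<m. S ! i) = {..<n} \<and>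
                       disjoint_family_on (\<lambda>i. S ! i) {..<m}}"

definition Cmax :: "nat set list \<Rightarrow> real list \<Rightarrow> real" where
  "Cmax S p = Max ((\<lambda>i. \<Sum>j\<in>S ! i. p ! j) ` {..<length S})"

definition OPT :: "nat \<Rightarrow> real list \<Rightarrow> real" where
  "OPT m p = Min ((\<lambda>S. Cmax S p) ` schedules m (length p))"

text \<open>
  The supremum is a maximum for the interval uncertainty sets below: they are nonempty, and
  \<^term>\<open>Cmax S\<close> is monotone in every job size, hence maximal at the upper interval bounds.
\<close>

definition worst_Cmax :: "nat set list \<Rightarrow> real list set \<Rightarrow> real" where
  "worst_Cmax S U = (SUP p\<in>U. Cmax S p)"

definition OPT_rob :: "nat \<Rightarrow> nat \<Rightarrow> real list set \<Rightarrow> real" where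
  "OPT_rob m n U = Min ((\<lambda>S. worst_Cmax S U) ` schedules m n)"

definition interval_uncertainty :: "nat \<Rightarrow> real list set \<Rightarrow> bool" where
  "interval_uncertainty n U \<longleftrightarrow>
     (\<exists>lo hi. length lo = n \<and> length hi = n \<and> (\<forall>j<n. 0 \<le> lo ! j \<and> lo ! j \<le> hi ! j) \<and>
        U = {p. length p = n \<and> (\<forall>j<n. lo ! j \<le> p ! j \<and> p ! j \<le> hi ! j)})"

text \<open>An input is an uncertainty set together with a predicted scenario \<open>q\<close>.\<close>

definition is_input :: "nat \<Rightarrow> real list set \<Rightarrow> real list \<Rightarrow> bool" where
  "is_input n U q \<longleftrightarrow> interval_uncertainty n U \<and> q \<in> U"

text \<open>
  Algorithms are modelled as total functions, but only their values on inputs are ever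
  constrained. The number of jobs is not a separate argument, since it is the length of \<open>q\<close>.
\<close>

type_synonym det_alg = "real list set \<Rightarrow> real list \<Rightarrow> nat set list"

definition det_algorithm :: "nat \<Rightarrow> det_alg \<Rightarrow> bool" where
  "det_algorithm m A \<longleftrightarrow> (\<forall>n U q. is_input n U q \<longrightarrow> A U q \<in> schedules m n)"

definition det_consistent :: "nat \<Rightarrow> real \<Rightarrow> det_alg \<Rightarrow> bool" where
  "det_consistent m \<alpha> A \<longleftrightarrow>
     (\<forall>n U q. is_input n U q \<longrightarrow> Cmax (A U q) q \<le> \<alpha> * OPT m q)"

definition det_robust :: "nat \<Rightarrow> real \<Rightarrow> det_alg \<Rightarrow> bool" where
  "det_robust m \<beta> A \<longleftrightarrow>
     (\<forall>n U q. is_input n U q \<longrightarrow> worst_Cmax (A U q) U \<le> \<beta> * OPT_rob m n U)"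

text \<open>
  There are only finitely many schedules for \<open>m\<close> machines and \<open>n\<close> jobs, so every random
  schedule is given by a probability mass function, and the expectations below are finite sums.
\<close>

type_synonym rand_alg = "real list set \<Rightarrow> real list \<Rightarrow> nat set list pmf"

definition rand_algorithm :: "nat \<Rightarrow> rand_alg \<Rightarrow> bool" where
  "rand_algorithm m A \<longleftrightarrow> (\<forall>n U q. is_input n U q \<longrightarrow> set_pmf (A U q) \<subseteq> schedules m n)"

definition rand_consistent :: "nat \<Rightarrow> real \<Rightarrow> rand_alg \<Rightarrow> bool" where
  "rand_consistent m \<alpha> A \<longleftrightarrow>
     (\<forall>n U q. is_input n U q \<longrightarrow>
        measure_pmf.expectation (A U q) (\<lambda>S. Cmax S q) \<le> \<alpha> * OPT m q)"

definition rand_robust :: "nat \<Rightarrow> real \<Rightarrow> rand_alg \<Rightarrow> bool" where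
  "rand_robust m \<beta> A \<longleftrightarrow>
     (\<forall>n U q. is_input n U q \<longrightarrow>
        (\<forall>p\<in>U. measure_pmf.expectation (A U q) (\<lambda>S. Cmax S p) \<le> \<beta> * OPT_rob m n U))"

lemma finite_schedules: "finite (schedules m n)"
proof (rule finite_subset)
  show "schedules m n \<subseteq> {S. set S \<subseteq> Pow {..<n} \<and> length S = m}"
    by (fastforce simp: schedules_def in_set_conv_nth)
  show "finite {S :: nat set list. set S \<subseteq> Pow {..<n} \<and> length S = m}"
    by (rule finite_lists_length_eq) simp
qed

end

theory Submission imports Defs begin

text \<open>
  For \<open>1 \<le> k \<le> m - 1\<close> take \<open>m - 1\<close> jobs of fixed size \<open>k\<close> and \<open>k\<close> jobs of predicted size \<open>1\<close> that
  may grow to a huge size \<open>M\<close>. The predicted optimum is \<open>k\<close>, and a schedule with predicted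
  makespan below \<open>k + 1\<close> has to put all uncertain jobs on one machine, so that its makespan
  grows to \<open>k * M\<close>. Spreading the uncertain jobs costs at most \<open>M + k\<close>.
  Part (i) uses \<open>k = \<lambda>\<close>. For part (ii), let \<open>x\<close> and \<open>y\<close> be the makespans of a schedule for the
  predicted and the largest scenario. Since \<open>x \<ge> k\<close> and \<open>y \<ge> M\<close>, the dichotomy gives the linear
  trade-off \<open>(x - k) * (k - 1) * M + y \<ge> k * M\<close>, which survives taking expectations; it is used
  with \<open>k = \<lceil>\<lambda>/2\<rceil>\<close>.
\<close>

section \<open>Bounds on the makespan of an arbitrary schedule\<close>

lemma load_le_Cmax: "i < length S \<Longrightarrow> (\<Sum>j\<in>S ! i. p ! j) \<le> Cmax S p"
  unfolding Cmax_def by (rule Max_ge) auto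

lemma Cmax_le:
  assumes "length S > 0" "\<And>i. i < length S \<Longrightarrow> (\<Sum>j\<in>S ! i. p ! j) \<le> c"
  shows "Cmax S p \<le> c"
  unfolding Cmax_def using assms by (subst Max_le_iff) auto

lemma schedules_length: "S \<in> schedules m n \<Longrightarrow> length S = m"
  by (simp add: schedules_def)

lemma schedules_subset: "S \<in> schedules m n \<Longrightarrow> i < m \<Longrightarrow> S ! i \<subseteq> {..<n}"
  by (auto simp: schedules_def)

lemma schedules_finite_nth: "S \<in> schedules m n \<Longrightarrow> i < m \<Longrightarrow> finite (S ! i)"
  by (meson finite_lessThan finite_subset schedules_subset)

lemma schedules_machine:
  assumes "S \<in> schedules m n" "j < n"
  obtains i where "i < m" "j \<in> S ! i"
  using assms by (auto simp: schedules_def)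

lemma sum_le_Cmax:
  assumes "S \<in> schedules m n" "i < m" "J \<subseteq> S ! i" "\<And>j. j < n \<Longrightarrow> 0 \<le> p ! j"
  shows "(\<Sum>j\<in>J. p ! j) \<le> Cmax S p"
proof -
  have "(\<Sum>j\<in>J. p ! j) \<le> (\<Sum>j\<in>S ! i. p ! j)"
    using assms schedules_subset[OF assms(1,2)]
    by (intro sum_mono2) (auto simp: schedules_finite_nth)
  also have "\<dots> \<le> Cmax S p"
    using assms by (intro load_le_Cmax) (simp add: schedules_length)
  finally show ?thesis .
qed

lemma job_le_Cmax:
  assumes "S \<in> schedules m n" "j < n" "\<And>j. j < n \<Longrightarrow> 0 \<le> p ! j"
  shows "p ! j \<le> Cmax S p"
proof -
  obtain i where "i < m" "j \<in> S ! i" using assms schedules_machine by blast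
  then show ?thesis using sum_le_Cmax[OF assms(1), of i "{j}" p] assms(3) by simp
qed

lemma Cmax_mono:
  assumes "S \<in> schedules m n" "m > 0" "\<And>j. j < n \<Longrightarrow> p ! j \<le> p' ! j"
  shows "Cmax S p \<le> Cmax S p'"
proof (rule Cmax_le)
  show "length S > 0" using assms by (simp add: schedules_length)
  fix i assume i: "i < length S"
  then have "S ! i \<subseteq> {..<n}" using assms schedules_subset schedules_length by blast
  then have "(\<Sum>j\<in>S ! i. p ! j) \<le> (\<Sum>j\<in>S ! i. p' ! j)"
    using assms(3) by (intro sum_mono) auto
  also have "\<dots> \<le> Cmax S p'" using i by (rule load_le_Cmax)
  finally show "(\<Sum>j\<in>S ! i. p ! j) \<le> Cmax S p'" .
qed

definition schedule_of :: "nat \<Rightarrow> nat \<Rightarrow> (nat \<Rightarrow> nat) \<Rightarrow> nat set list" where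
  "schedule_of m n f = map (\<lambda>i. {j. j < n \<and> f j = i}) [0..<m]"

lemma schedule_of_nth: "i < m \<Longrightarrow> schedule_of m n f ! i = {j. j < n \<and> f j = i}"
  by (simp add: schedule_of_def)

lemma schedule_of_in_schedules:
  "(\<And>j. j < n \<Longrightarrow> f j < m) \<Longrightarrow> schedule_of m n f \<in> schedules m n"
  by (auto simp: schedules_def schedule_of_def disjoint_family_on_def)

section \<open>Interval boxes and the family of hard instances\<close>

definition box :: "real list \<Rightarrow> real list \<Rightarrow> real list set" where
  "box lo hi = {p. length p = length lo \<and> (\<forall>j<length lo. lo ! j \<le> p ! j \<and> p ! j \<le> hi ! j)}"

lemma worst_Cmax_box:
  assumes "S \<in> schedules m n" "m > 0" "length lo = n" "length hi = n"
    "\<And>j. j < n \<Longrightarrow> lo ! j \<le> hi ! j"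
  shows "worst_Cmax S (box lo hi) = Cmax S hi"
  unfolding worst_Cmax_def
proof (rule cSup_eq_maximum)
  show "Cmax S hi \<in> Cmax S ` box lo hi" using assms by (auto simp: box_def)
  fix x assume "x \<in> Cmax S ` box lo hi"
  then show "x \<le> Cmax S hi" using assms by (auto simp: box_def intro!: Cmax_mono)
qed

text \<open>The \<open>r\<close> fixed jobs come first, so the uncertain jobs are exactly
  \<open>{r..<r + k}\<close>. The number of machines is written \<open>Suc r\<close>: one machine
  more than there are fixed jobs.\<close>

definition scenario :: "nat \<Rightarrow> nat \<Rightarrow> real \<Rightarrow> real list" where
  "scenario r k x = replicate r (real k) @ replicate k x"

lemma length_scenario [simp]: "length (scenario r k x) = r + k"
  by (simp add: scenario_def)

lemma scenario_nth:
  "j < r + k \<Longrightarrow> scenario r k x ! j = (if j < r then real k else x)"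
  by (auto simp: scenario_def nth_append)

lemma is_input_scenario:
  assumes "M \<ge> 1"
  shows "is_input (r + k) (box (scenario r k 1) (scenario r k M)) (scenario r k 1)"
  unfolding is_input_def interval_uncertainty_def
proof (intro conjI exI)
  show "scenario r k 1 \<in> box (scenario r k 1) (scenario r k M)"
    using assms by (auto simp: box_def scenario_nth)
  show "box (scenario r k 1) (scenario r k M) = {p. length p = r + k \<and>
      (\<forall>j<r + k. scenario r k 1 ! j \<le> p ! j \<and> p ! j \<le> scenario r k M ! j)}"
    by (simp add: box_def)
qed (use assms in \<open>auto simp: scenario_nth\<close>)

text \<open>A fixed job shares its machine with no other job, since any second job would lift the
  predicted load to at least \<open>k + 1\<close>. The fixed jobs thus block \<open>r\<close> of the
  \<open>Suc r\<close> machines, and all uncertain jobs are left with the same one.\<close>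

lemma Cmax_scenario_dichotomy:
  assumes S: "S \<in> schedules (Suc r) (r + k)" and k: "1 \<le> k" and M: "0 \<le> M"
    and less: "Cmax S (scenario r k 1) < real k + 1"
  shows "real k * M \<le> Cmax S (scenario r k M)"
proof -
  have "\<exists>i. i < Suc r \<and> j \<in> S ! i" if "j < r + k" for j
    using schedules_machine[OF S that] by blast
  then obtain f where f: "f j < Suc r" "j \<in> S ! f j" if "j < r + k" for j
    by metis
  have pair: "scenario r k 1 ! j + scenario r k 1 ! j' < real k + 1"
    if "j < r + k" "j' < r + k" "j \<noteq> j'" "f j = f j'" for j j'
  proof -
    have "(\<Sum>a\<in>{j, j'}. scenario r k 1 ! a) \<le> Cmax S (scenario r k 1)"
    proof (rule sum_le_Cmax[OF S])
      show "f j < Suc r" using f that by blast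
      show "{j, j'} \<subseteq> S ! f j" using f(2)[of j] f(2)[of j'] that by simp
    qed (simp add: scenario_nth)
    then show ?thesis using less that by simp
  qed
  have inj: "inj_on f {..<r}"
  proof (rule inj_onI)
    fix j j' assume "j \<in> {..<r}" "j' \<in> {..<r}" "f j = f j'"
    \<comment> \<open>Two fixed jobs together have size \<open>2 * k\<close>, which is at least
      \<open>k + 1\<close> because \<open>k\<close> is at least 1.\<close>
    then show "j = j'" using pair[of j j'] k by (force simp: scenario_nth)
  qed
  have "card ({..<Suc r} - f ` {..<r}) = 1"
    using f(1) inj by (subst card_Diff_subset) (auto simp: card_image)
  then obtain i where i: "{..<Suc r} - f ` {..<r} = {i}" using card_1_singletonE by blast
  have "f j = i" if j: "j \<in> {r..<r + k}" for j
  proof -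
    have "f j \<notin> f ` {..<r}"
    proof
      assume "f j \<in> f ` {..<r}"
      then obtain j' where "j' < r" "f j = f j'" by auto
      then show False using pair[of j j'] j by (simp add: scenario_nth)
    qed
    then show ?thesis using f(1)[of j] i j by auto
  qed
  then have "{r..<r + k} \<subseteq> S ! i" using f(2) by fastforce
  moreover have "i < Suc r" using i by auto
  ultimately have "(\<Sum>j\<in>{r..<r + k}. scenario r k M ! j) \<le> Cmax S (scenario r k M)"
    using M by (intro sum_le_Cmax[OF S]) (auto simp: scenario_nth)
  then show ?thesis by (simp add: scenario_nth)
qed

lemma Cmax_scenario_ge_big:
  assumes "S \<in> schedules (Suc r) (r + k)" "1 \<le> r" "0 \<le> M"
  shows "real k \<le> Cmax S (scenario r k M)"
  using job_le_Cmax[OF assms(1), of 0 "scenario r k M"] assms by (simp add: scenario_nth)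

lemma Cmax_scenario_ge_small:
  assumes "S \<in> schedules (Suc r) (r + k)" "1 \<le> k" "0 \<le> M"
  shows "M \<le> Cmax S (scenario r k M)"
  using job_le_Cmax[OF assms(1), of r "scenario r k M"] assms by (simp add: scenario_nth)

lemma OPT_scenario:
  assumes "1 \<le> r"
  shows "OPT (Suc r) (scenario r k 1) = real k"
proof (rule antisym)
  \<comment> \<open>Each fixed job gets a machine of its own and the last machine takes all
    \<open>k\<close> unit jobs, so every load is exactly \<open>k\<close>. A single fixed job
    already forces this value.\<close>
  define S where "S = schedule_of (Suc r) (r + k) (\<lambda>j. min j r)"
  have S: "S \<in> schedules (Suc r) (r + k)"
    unfolding S_def by (rule schedule_of_in_schedules) simp
  have "Cmax S (scenario r k 1) \<le> real k"
  proof (rule Cmax_le)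
    fix i assume "i < length S"
    then have i: "i < Suc r" using S by (simp add: schedules_length)
    have "S ! i = (if i < r then {i} else {r..<r + k})"
      using i by (auto simp: S_def schedule_of_nth min_def)
    then show "(\<Sum>j\<in>S ! i. scenario r k 1 ! j) \<le> real k"
      by (auto simp: scenario_nth)
  qed (use S in \<open>simp add: schedules_length\<close>)
  moreover have "OPT (Suc r) (scenario r k 1) \<le> Cmax S (scenario r k 1)"
    unfolding OPT_def using S by (intro Min_le) (auto simp: finite_schedules)
  ultimately show "OPT (Suc r) (scenario r k 1) \<le> real k" by simp
  show "real k \<le> OPT (Suc r) (scenario r k 1)"
    unfolding OPT_def using S assms
    by (subst Min_ge_iff) (auto simp: finite_schedules intro: Cmax_scenario_ge_big)
qed

lemma worst_Cmax_scenario: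
  assumes "S \<in> schedules (Suc r) (r + k)" "1 \<le> M"
  shows "worst_Cmax S (box (scenario r k 1) (scenario r k M)) = Cmax S (scenario r k M)"
  using assms by (intro worst_Cmax_box) (auto simp: scenario_nth)

lemma OPT_rob_scenario:
  assumes "k \<le> r" "1 \<le> r" "1 \<le> M"
  defines "U \<equiv> box (scenario r k 1) (scenario r k M)"
  shows "OPT_rob (Suc r) (r + k) U \<le> M + real k" "0 \<le> OPT_rob (Suc r) (r + k) U"
proof -
  \<comment> \<open>The uncertain job \<open>r + i\<close> joins the fixed job \<open>i\<close>;
    \<open>k \<le> r\<close> provides enough such machines, and machine \<open>r\<close> stays
    empty.\<close>
  define S where "S = schedule_of (Suc r) (r + k) (\<lambda>j. if j < r then j else j - r)"
  have S: "S \<in> schedules (Suc r) (r + k)"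
    unfolding S_def using assms by (intro schedule_of_in_schedules) auto
  have "Cmax S (scenario r k M) \<le> M + real k"
  proof (rule Cmax_le)
    fix i assume "i < length S"
    then have i: "i < Suc r" using S by (simp add: schedules_length)
    have "S ! i = (if i < r then {i} else {}) \<union> (if i < k then {r + i} else {})"
      using i assms by (auto simp: S_def schedule_of_nth)
    then show "(\<Sum>j\<in>S ! i. scenario r k M ! j) \<le> M + real k"
      using assms by (auto simp: scenario_nth)
  qed (use S in \<open>simp add: schedules_length\<close>)
  moreover have "OPT_rob (Suc r) (r + k) U \<le> worst_Cmax S U"
    unfolding OPT_rob_def using S by (intro Min_le) (auto simp: finite_schedules)
  ultimately show "OPT_rob (Suc r) (r + k) U \<le> M + real k"
    using worst_Cmax_scenario[OF S assms(3)] by (simp add: U_def)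
  have "0 \<le> worst_Cmax T U" if T: "T \<in> schedules (Suc r) (r + k)" for T
  proof -
    have "real k \<le> Cmax T (scenario r k M)"
      using Cmax_scenario_ge_big T assms by simp
    then show ?thesis using worst_Cmax_scenario[OF T assms(3)] by (simp add: U_def)
  qed
  then show "0 \<le> OPT_rob (Suc r) (r + k) U"
    unfolding OPT_rob_def using S by (subst Min_ge_iff) (auto simp: finite_schedules)
qed

text \<open>For large \<open>M\<close> the additive \<open>k\<close> in the robust optimum is
  negligible. With \<open>b = max \<beta> 0\<close>, the chosen \<open>M\<close> makes
  \<open>c * M - b * (M + k)\<close> equal to \<open>c - b\<close>, which is positive.\<close>

lemma exists_large_size:
  fixes \<beta> c :: real and k :: nat
  assumes "\<beta> < c" "0 < c"
  obtains M where "1 \<le> M" "max \<beta> 0 * (M + real k) < c * M"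
proof -
  define b where "b = max \<beta> 0"
  define M where "M = 1 + b * real k / (c - b)"
  have b: "0 \<le> b" "b < c" using assms by (auto simp: b_def)
  have "(c - b) * M = (c - b) + b * real k"
    using less_imp_neq[OF b(2)] by (simp add: M_def distrib_left)
  then have "b * (M + real k) < c * M" using b by (simp add: algebra_simps)
  moreover have "1 \<le> M" using b by (simp add: M_def)
  ultimately show ?thesis using that by (simp add: b_def)
qed

text \<open>As \<beta> may be negative, the upper bound on \<open>OPT_rob\<close> can be multiplied
  only by \<open>max \<beta> 0\<close>; passing from \<beta> to this factor uses that
  \<open>OPT_rob\<close> is nonnegative.\<close>

lemma robust_bound_scenario:
  assumes "k \<le> r" "1 \<le> r" "1 \<le> M"
  shows "\<beta> * OPT_rob (Suc r) (r + k) (box (scenario r k 1) (scenario r k M))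
    \<le> max \<beta> 0 * (M + real k)"
  using OPT_rob_scenario[OF assms] by (intro mult_mono) auto

section \<open>The lower bound for deterministic algorithms\<close>

lemma no_det_algorithm:
  assumes l: "1 \<le> l" "l \<le> r" and \<alpha>: "\<alpha> < 1 + 1 / real l" and \<beta>: "\<beta> < real l"
    and A: "det_algorithm (Suc r) A" "det_consistent (Suc r) \<alpha> A" "det_robust (Suc r) \<beta> A"
  shows False
proof -
  obtain M where M: "1 \<le> M" "max \<beta> 0 * (M + real l) < real l * M"
    using exists_large_size[OF \<beta>] l by auto
  define U where "U = box (scenario r l 1) (scenario r l M)"
  define S where "S = A U (scenario r l 1)"
  have inp: "is_input (r + l) U (scenario r l 1)"
    unfolding U_def by (rule is_input_scenario[OF M(1)])
  have S: "S \<in> schedules (Suc r) (r + l)"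
    using A(1) inp unfolding det_algorithm_def S_def by blast
  have "Cmax S (scenario r l 1) \<le> \<alpha> * real l"
    using A(2) inp OPT_scenario[of r l] l unfolding det_consistent_def S_def by fastforce
  \<comment> \<open>The threshold \<open>1 + 1 / l\<close> times the predicted optimum
    \<open>l\<close> is exactly the bound \<open>l + 1\<close> of the dichotomy.\<close>
  also have "\<dots> < real l + 1" using \<alpha> l by (simp add: field_simps)
  finally have "real l * M \<le> Cmax S (scenario r l M)"
    using Cmax_scenario_dichotomy[OF S l(1)] M by simp
  also have "\<dots> = worst_Cmax S U"
    unfolding U_def using worst_Cmax_scenario[OF S M(1)] by simp
  also have "\<dots> \<le> \<beta> * OPT_rob (Suc r) (r + l) U"
    using A(3) inp unfolding det_robust_def S_def by blast
  also have "\<dots> \<le> max \<beta> 0 * (M + real l)"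
    unfolding U_def using l M by (intro robust_bound_scenario) auto
  finally show False using M by simp
qed

section \<open>The lower bound for randomized algorithms\<close>

lemma expectation_trade_off:
  assumes P: "set_pmf P \<subseteq> schedules (Suc r) (r + k)" and k: "1 \<le> k" "1 \<le> r" and M: "0 \<le> M"
  shows "real k * M \<le>
    (measure_pmf.expectation P (\<lambda>S. Cmax S (scenario r k 1)) - real k) * ((real k - 1) * M) +
    measure_pmf.expectation P (\<lambda>S. Cmax S (scenario r k M))"
proof -
  have fin: "finite (set_pmf P)" using P finite_schedules finite_subset by blast
  have int: "integrable (measure_pmf P) f" for f :: "nat set list \<Rightarrow> real"
    using fin by (rule integrable_measure_pmf_finite)
  \<comment> \<open>The slope \<open>(k - 1) * M\<close> is the gap between the two lower bounds
    \<open>k * M\<close> and \<open>M\<close> on the large makespan. If the predicted makespan is at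
    least \<open>k + 1\<close>, the first summand closes this gap; otherwise it is nonnegative and
    the dichotomy suffices.\<close>
  have pointwise: "real k * M \<le>
      (Cmax S (scenario r k 1) - real k) * ((real k - 1) * M) + Cmax S (scenario r k M)"
    if "S \<in> set_pmf P" for S
  proof -
    have S: "S \<in> schedules (Suc r) (r + k)" using P that by blast
    show ?thesis
    proof (cases "Cmax S (scenario r k 1) < real k + 1")
      case True
      have "0 \<le> (Cmax S (scenario r k 1) - real k) * ((real k - 1) * M)"
        using Cmax_scenario_ge_big[OF S k(2), of 1] k M by simp
      then show ?thesis using Cmax_scenario_dichotomy[OF S k(1) M True] by simp
    next
      case False
      have "1 * ((real k - 1) * M) \<le> (Cmax S (scenario r k 1) - real k) * ((real k - 1) * M)"
        using False k M by (intro mult_right_mono) auto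
      then show ?thesis using Cmax_scenario_ge_small[OF S k(1) M] by (simp add: algebra_simps)
    qed
  qed
  have "real k * M = measure_pmf.expectation P (\<lambda>S. real k * M)" by simp
  also have "\<dots> \<le> measure_pmf.expectation P (\<lambda>S.
      (Cmax S (scenario r k 1) - real k) * ((real k - 1) * M) + Cmax S (scenario r k M))"
    using pointwise by (intro integral_mono_AE int) (simp add: AE_measure_pmf_iff)
  also have "\<dots> = (measure_pmf.expectation P (\<lambda>S. Cmax S (scenario r k 1)) - real k) *
      ((real k - 1) * M) + measure_pmf.expectation P (\<lambda>S. Cmax S (scenario r k M))"
    by (simp add: int)
  finally show ?thesis .
qed

lemma no_rand_algorithm:
  assumes l: "1 \<le> l" "l \<le> r" and \<alpha>: "\<alpha> < 1 + 1 / real l" and \<beta>: "\<beta> < real l / 4"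
    and A: "rand_algorithm (Suc r) A" "rand_consistent (Suc r) \<alpha> A" "rand_robust (Suc r) \<beta> A"
  shows False
proof -
  \<comment> \<open>Up to terms that vanish for large \<open>M\<close>, the trade-off forces \<beta>
    to be at least \<open>k * (l + 1 - k) / l\<close>. This quadratic peaks at
    \<open>(l + 1) / 2\<close>; rounding down keeps the value above \<open>l / 4\<close>.\<close>
  define k where "k = (l + 1) div 2"
  have k: "1 \<le> k" "k \<le> r" using l by (auto simp: k_def)
  obtain M where M: "1 \<le> M" "max \<beta> 0 * (M + real k) < real l / 4 * M"
    using exists_large_size[OF \<beta>] l by auto
  define U where "U = box (scenario r k 1) (scenario r k M)"
  define P where "P = A U (scenario r k 1)"
  have inp: "is_input (r + k) U (scenario r k 1)"
    unfolding U_def by (rule is_input_scenario[OF M(1)])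
  have P: "set_pmf P \<subseteq> schedules (Suc r) (r + k)"
    using A(1) inp unfolding rand_algorithm_def P_def by blast
  let ?Eq = "measure_pmf.expectation P (\<lambda>S. Cmax S (scenario r k 1))"
  let ?Et = "measure_pmf.expectation P (\<lambda>S. Cmax S (scenario r k M))"
  have "?Eq \<le> \<alpha> * real k"
    using A(2) inp OPT_scenario[of r k] k unfolding rand_consistent_def P_def by fastforce
  also have "\<dots> \<le> (1 + 1 / real l) * real k"
    using \<alpha> by (intro mult_right_mono) auto
  \<comment> \<open>Consistency leaves an expected excess of only \<open>k / l\<close> over the
    predicted optimum \<open>k\<close>, so the costly event of staying at or above
    \<open>k + 1\<close> is limited.\<close>
  finally have Eq: "?Eq - real k \<le> real k / real l" by (simp add: algebra_simps)
  have hi: "scenario r k M \<in> U" using M by (auto simp: U_def box_def scenario_nth)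
  have "?Et \<le> \<beta> * OPT_rob (Suc r) (r + k) U"
    using A(3) inp hi unfolding rand_robust_def P_def by blast
  also have "\<dots> \<le> max \<beta> 0 * (M + real k)"
    unfolding U_def using k M by (intro robust_bound_scenario) auto
  finally have Et: "?Et < real l / 4 * M" using M by simp
  have "real k * M \<le> (?Eq - real k) * ((real k - 1) * M) + ?Et"
    using k M by (intro expectation_trade_off[OF P]) auto
  also have "\<dots> < real k / real l * ((real k - 1) * M) + real l / 4 * M"
    using Eq Et k M by (intro add_le_less_mono mult_right_mono) auto
  also have "\<dots> = (real k * (real k - 1) / real l + real l / 4) * M"
    by (simp add: algebra_simps add_divide_distrib diff_divide_distrib)
  finally have "real k < real k * (real k - 1) / real l + real l / 4"
    using M by simp
  then have less: "4 * real k * real l < 4 * (real k * (real k - 1)) + real l * real l"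
    using l by (simp add: field_simps)
  \<comment> \<open>Completing the square turns \<open>less\<close> into
    \<open>4 * k < (l - 2 * k)^2\<close>, whereas the rounding in \<open>k\<close> keeps this square
    at most 1.\<close>
  have "real l = 2 * real k \<or> real l = 2 * real k - 1"
    unfolding k_def by (cases "even l") (auto elim!: evenE oddE)
  then have "(real l - 2 * real k)\<^sup>2 \<le> 1" by auto
  then show False using less k by (simp add: power2_eq_square algebra_simps)
qed

theorem theorem5:
  fixes m l :: nat and \<alpha> :: real
  assumes "m \<ge> 2" and "1 \<le> l" and "l \<le> m - 1" and "\<alpha> < 1 + 1 / real l"
  shows "(\<forall>\<beta>::real. \<beta> < real l \<longrightarrow>
            \<not> (\<exists>A. det_algorithm m A \<and> det_consistent m \<alpha> A \<and> det_robust m \<beta> A)) \<and>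
         (\<forall>\<beta>::real. \<beta> < real l / 4 \<longrightarrow>
            \<not> (\<exists>A. rand_algorithm m A \<and> rand_consistent m \<alpha> A \<and> rand_robust m \<beta> A))"
proof -
  have m: "m = Suc (m - 1)" using assms by simp
  show ?thesis
    using no_det_algorithm[OF assms(2,3,4)] no_rand_algorithm[OF assms(2,3,4)]
    unfolding m[symmetric] by blast
qed

end
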